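(* Let $G$ be a finite simple triangle-free graph with at least one edge. Then for every integer $n\ge 3$, $$\chi_i'(S_G^3)\le \chi_i'(S_G^n)\le \chi_i'(S_G^3)+1.$$ Moreover, writing $k=\chi_i'(S_G^3)$, we have $\chi_i'(S_G^n)=\chi_i'(S_G^3)$ for all $n\ge 3$ whenever at least one of the following holds: (i) there is an injective edge $k$-coloring of $S_G^3$ such that every vertex of $S_G^3$ incident to an edge of color $k$ is at distance at least $3$ (in $S_G^3$) from every extreme vertex $(u,u,u)$, $u\in V(G)$; or (ii) $G$ is bipartite with bipartition $V(G)=A\cup B$, and there is an injective edge $k$-coloring of $S_G^3$ such that for every $u\in A$ all edges incident with the extreme vertex $(u,u,u)$ receive color $k$, and every vertex of $S_G^3$ incident to an edge of color $k$ is at distance at least $2$ (in $S_G^3$) from every extreme vertex $(v,v,v)$ with $v\in B$.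
   Context: For a graph $H$ with at least one edge, an injective edge $k$-coloring is a map $c:E(H)\to\{1,\dots,k\}$ such that whenever $e_1=xy$, $e_2=yz$, $e_3=zu$ are edges of $H$ with $x,y,z$ distinct and $u\notin\{y,z\}$ (the case $u=x$ being allowed), we have $c(e_1)\ne c(e_3)$. The injective chromatic index $\chi_i'(H)$ is the least $k$ for which such a coloring exists. For a graph $G$ and positive integer $n$, the generalized Sierpiński graph $S_G^n$ has vertex set $V(G)^n$, and $(u_1,\dots,u_n)$, $(v_1,\dots,v_n)$ are adjacent if and only if there is $d\in\{1,\dots,n\}$ with $u_i=v_i$ for $i<d$, $u_dv_d\in E(G)$, and $u_i=v_d$, $v_i=u_d$ for all $i>d$. The extreme vertices of $S_G^n$ are the vertices $(u,\dots,u)$, $u\in V(G)$. *)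

theory Defs
  imports Main "HOL-Library.Extended_Nat"
begin

definition simple_graph :: "'a set \<Rightarrow> ('a \<Rightarrow> 'a \<Rightarrow> bool) \<Rightarrow> bool" where
  "simple_graph V adj \<longleftrightarrow>
     (\<forall>x y. adj x y \<longrightarrow> x \<in> V \<and> y \<in> V) \<and>
     (\<forall>x y. adj x y \<longrightarrow> adj y x) \<and>
     (\<forall>x. \<not> adj x x)"

definition triangle_free :: "('a \<Rightarrow> 'a \<Rightarrow> bool) \<Rightarrow> bool" where
  "triangle_free adj \<longleftrightarrow> \<not> (\<exists>x y z. adj x y \<and> adj y z \<and> adj z x)"

definition has_edge :: "('a \<Rightarrow> 'a \<Rightarrow> bool) \<Rightarrow> bool" where
  "has_edge adj \<longleftrightarrow> (\<exists>x y. adj x y)"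

definition edges :: "('a \<Rightarrow> 'a \<Rightarrow> bool) \<Rightarrow> 'a set set" where
  "edges adj = {{x, y} | x y. adj x y}"

definition inj_edge_coloring ::
  "('a \<Rightarrow> 'a \<Rightarrow> bool) \<Rightarrow> nat \<Rightarrow> ('a set \<Rightarrow> nat) \<Rightarrow> bool" where
  "inj_edge_coloring adj k c \<longleftrightarrow>
     (\<forall>e \<in> edges adj. c e \<in> {1..k}) \<and>
     (\<forall>x y z u. adj x y \<and> adj y z \<and> adj z u \<and> x \<noteq> y \<and> y \<noteq> z \<and> x \<noteq> z
        \<and> u \<noteq> y \<and> u \<noteq> z \<longrightarrow> c {x, y} \<noteq> c {z, u})"

definition inj_chromatic_index :: "('a \<Rightarrow> 'a \<Rightarrow> bool) \<Rightarrow> nat" where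
  "inj_chromatic_index adj = (LEAST k. \<exists>c. inj_edge_coloring adj k c)"

definition sierp_verts :: "'a set \<Rightarrow> nat \<Rightarrow> 'a list set" where
  "sierp_verts V n = {w. length w = n \<and> set w \<subseteq> V}"

definition sierp_adj ::
  "'a set \<Rightarrow> ('a \<Rightarrow> 'a \<Rightarrow> bool) \<Rightarrow> nat \<Rightarrow> 'a list \<Rightarrow> 'a list \<Rightarrow> bool" where
  "sierp_adj V adj n u v \<longleftrightarrow>
     u \<in> sierp_verts V n \<and> v \<in> sierp_verts V n \<and>
     (\<exists>d < n. (\<forall>i < d. u ! i = v ! i) \<and> adj (u ! d) (v ! d) \<and>
        (\<forall>i. d < i \<and> i < n \<longrightarrow> u ! i = v ! d \<and> v ! i = u ! d))"

definition extreme_vertex :: "nat \<Rightarrow> 'a \<Rightarrow> 'a list" where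
  "extreme_vertex n u = replicate n u"

definition gdist :: "('a \<Rightarrow> 'a \<Rightarrow> bool) \<Rightarrow> 'a \<Rightarrow> 'a \<Rightarrow> enat" where
  "gdist adj x y = (if \<exists>j. (adj ^^ j) x y then enat (LEAST j. (adj ^^ j) x y) else \<infinity>)"

definition bipartition :: "'a set \<Rightarrow> ('a \<Rightarrow> 'a \<Rightarrow> bool) \<Rightarrow> 'a set \<Rightarrow> 'a set \<Rightarrow> bool" where
  "bipartition V adj A B \<longleftrightarrow> A \<union> B = V \<and> A \<inter> B = {} \<and>
     (\<forall>x y. adj x y \<longrightarrow> (x \<in> A \<and> y \<in> B) \<or> (x \<in> B \<and> y \<in> A))"

end

theory Submission
  imports Defs
begin

text \<open>
  \<open>S (m + 1)\<close> consists of copies \<open>a # S m\<close> joined by the edges \<open>{a b^m, b a^m}\<close> with \<open>ab\<close> an edge of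
  \<open>G\<close>. Copy a coloring of \<open>S m\<close> into every copy, orient every edge of \<open>G\<close>, and give one color \<open>K\<close>
  to the whole star of each joining edge at one of its ends, as chosen by the orientation. These
  stars are far apart, so conflicts arise only with \<open>K\<close>-colored edges near extreme vertices. There
  are none if \<open>K\<close> is a new color or under (i).

  Under (ii), let the stars be centred at the ends in \<open>A\<close>, where they already have color \<open>K\<close>.
  A conflict is then possible only if \<open>a \<in> A\<close> is a pendant vertex of \<open>G\<close>, say at \<open>b \<in> B\<close>: the single
  edge at \<open>aaa\<close> does not prevent further edges at \<open>aab\<close> from having color \<open>K\<close>. In that case the
  copy \<open>a\<close> of \<open>S 2\<close> hangs on a bridge and can be recolored like the copy \<open>b\<close>, where \<open>K\<close> does not
  occur near \<open>bbb\<close>.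
\<close>

section \<open>Injective edge colorings and the chromatic index\<close>

lemma inj_edge_coloringD:
  assumes "inj_edge_coloring E k c" "\<And>x. \<not> E x x"
    and "E x y" "E y z" "E z u" "x \<noteq> z" "u \<noteq> y"
  shows "c {x, y} \<noteq> c {z, u}"
  using assms unfolding inj_edge_coloring_def by metis

lemma inj_edge_coloring_range:
  "inj_edge_coloring E k c \<Longrightarrow> E x y \<Longrightarrow> c {x, y} \<in> {1..k}"
  unfolding inj_edge_coloring_def edges_def by blast

lemma inj_edge_coloringI:
  assumes "\<And>x y. E x y \<Longrightarrow> c {x, y} \<in> {1..k}"
    and "\<And>x y z u. E x y \<Longrightarrow> E y z \<Longrightarrow> E z u \<Longrightarrow> x \<noteq> z \<Longrightarrow> u \<noteq> y \<Longrightarrow> c {x, y} \<noteq> c {z, u}"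
  shows "inj_edge_coloring E k c"
  unfolding inj_edge_coloring_def edges_def using assms by auto

lemma inj_chromatic_index_le: "inj_edge_coloring E k c \<Longrightarrow> inj_chromatic_index E \<le> k"
  unfolding inj_chromatic_index_def by (rule Least_le) blast

text \<open>Coloring all edges differently shows that some number of colors suffices, so the
  \<open>LEAST\<close> in the definition of the index is attained.\<close>

lemma inj_chromatic_index_attained:
  assumes "finite (edges E)"
  shows "\<exists>c. inj_edge_coloring E (inj_chromatic_index E) c"
proof -
  obtain f :: "'a set \<Rightarrow> nat" where f: "bij_betw f (edges E) {0..<card (edges E)}"
    using ex_bij_betw_finite_nat[OF assms] by blast
  have inE: "{x, y} \<in> edges E" if "E x y" for x y
    using that unfolding edges_def by blast
  have "inj_edge_coloring E (card (edges E)) (\<lambda>e. Suc (f e))"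
    unfolding inj_edge_coloring_def
  proof (intro conjI ballI allI impI)
    fix e assume "e \<in> edges E"
    then have "f e \<in> {0..<card (edges E)}" using f by (auto simp: bij_betw_def)
    then show "Suc (f e) \<in> {1..card (edges E)}" by auto
  next
    fix x y z u
    assume a: "E x y \<and> E y z \<and> E z u \<and> x \<noteq> y \<and> y \<noteq> z \<and> x \<noteq> z \<and> u \<noteq> y \<and> u \<noteq> z"
    then have "{x, y} \<noteq> {z, u}" by (auto simp: doubleton_eq_iff)
    then show "Suc (f {x, y}) \<noteq> Suc (f {z, u})"
      using a inE bij_betw_imp_inj_on[OF f] by (metis inj_onD nat.inject)
  qed
  then show ?thesis
    unfolding inj_chromatic_index_def by (intro LeastI_ex[of "\<lambda>k. \<exists>c. inj_edge_coloring E k c"]) blast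
qed

section \<open>Recursive structure of generalized Sierpinski graphs\<close>

locale sgraph =
  fixes V :: "'a set" and adj :: "'a \<Rightarrow> 'a \<Rightarrow> bool"
  assumes simple: "simple_graph V adj"
begin

abbreviation S where "S \<equiv> sierp_adj V adj"

lemma adj_V: "adj x y \<Longrightarrow> x \<in> V" "adj x y \<Longrightarrow> y \<in> V"
  and adj_sym: "adj x y \<Longrightarrow> adj y x"
  and adj_irrefl [simp]: "\<not> adj x x"
  using simple unfolding simple_graph_def by blast+

lemma sierp_adj_0 [simp]: "\<not> S 0 s t"
  unfolding sierp_adj_def by simp

text \<open>This splits on the position \<open>d\<close> in \<open>sierp_adj\<close>:
  \<open>d = 0\<close> gives an edge joining two copies, and \<open>d > 0\<close> is an adjacency of
  the tails with \<open>d\<close> shifted by one.\<close>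

lemma sierp_adj_Cons:
  "S (Suc m) (x # s) (y # t) \<longleftrightarrow>
     (x = y \<and> x \<in> V \<and> S m s t) \<or> (adj x y \<and> s = replicate m y \<and> t = replicate m x)"
proof -
  have all0: "(\<forall>i. 0 < i \<and> i < Suc m \<longrightarrow> P i) \<longleftrightarrow> (\<forall>i<m. P (Suc i))" for P :: "nat \<Rightarrow> bool"
    by (metis Suc_less_eq Suc_pred zero_less_Suc)
  have allS: "(\<forall>i. Suc d < i \<and> i < Suc m \<longrightarrow> P i) \<longleftrightarrow> (\<forall>i. d < i \<and> i < m \<longrightarrow> P (Suc i))"
    for P :: "nat \<Rightarrow> bool" and d
    by (metis Suc_less_eq Suc_lessE)
  have rep: "length s = m \<and> (\<forall>i<m. s ! i = a) \<longleftrightarrow> s = replicate m a" for s :: "'a list" and a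
    by (auto simp: list_eq_iff_nth_eq)
  have "S (Suc m) (x # s) (y # t) \<longleftrightarrow>
     length s = m \<and> length t = m \<and> x \<in> V \<and> y \<in> V \<and> set s \<subseteq> V \<and> set t \<subseteq> V \<and>
     ((adj x y \<and> (\<forall>i<m. s ! i = y \<and> t ! i = x)) \<or>
      (\<exists>d<m. x = y \<and> (\<forall>i<d. s ! i = t ! i) \<and> adj (s ! d) (t ! d) \<and>
        (\<forall>i. d < i \<and> i < m \<longrightarrow> s ! i = t ! d \<and> t ! i = s ! d)))"
    unfolding sierp_adj_def sierp_verts_def Ex_less_Suc2 All_less_Suc2 all0 allS by auto
  also have "\<dots> \<longleftrightarrow> (x = y \<and> x \<in> V \<and> S m s t) \<or>
      (adj x y \<and> s = replicate m y \<and> t = replicate m x)"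
    unfolding sierp_adj_def sierp_verts_def rep[symmetric]
    by (auto simp: set_conv_nth dest: adj_V)
  finally show ?thesis .
qed

lemma sierp_adj_length: "S m s t \<Longrightarrow> length s = m" "S m s t \<Longrightarrow> length t = m"
  unfolding sierp_adj_def sierp_verts_def by auto

lemma sierp_adj_sym: "S m s t \<Longrightarrow> S m t s"
  unfolding sierp_adj_def by (metis adj_sym)

lemma sierp_adj_irrefl [simp]: "\<not> S m s s"
  unfolding sierp_adj_def by auto

lemma sierp_adj_SucE:
  assumes "S (Suc m) v w"
  obtains (inner) x s t where "v = x # s" "w = x # t" "x \<in> V" "S m s t"
  | (link) x y where "v = x # replicate m y" "w = y # replicate m x" "adj x y"
proof -
  obtain x s y t where "v = x # s" "w = y # t"
    using sierp_adj_length[OF assms] by (metis length_Suc_conv)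
  then show ?thesis using assms that by (auto simp: sierp_adj_Cons)
qed

lemma finite_edges_sierp:
  assumes "finite V"
  shows "finite (edges (S n))"
proof -
  have "finite (sierp_verts V n)"
    unfolding sierp_verts_def using finite_lists_length_eq[OF assms, of n]
    by (simp add: conj_commute)
  moreover have "edges (S n) \<subseteq> Pow (sierp_verts V n)"
    unfolding edges_def sierp_adj_def by auto
  ultimately show ?thesis by (meson finite_Pow_iff finite_subset)
qed

text \<open>A joining edge at a vertex of copy \<open>a\<close> needs a tail constantly equal to
  some neighbor of \<open>a\<close>, and the nonempty tail of an extreme vertex is constantly
  \<open>a\<close> instead.\<close>

lemma sierp_adj_replicateD:
  assumes "S (Suc m) (replicate (Suc m) a) y" "m \<ge> 1"
  shows "\<exists>y'. y = a # y' \<and> S m (replicate m a) y'"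
  using assms by (cases m) (auto elim!: sierp_adj_SucE simp: sierp_adj_Cons)

lemma sierp_adj_not_linkD:
  assumes "S (Suc m) (a # s) v" "\<And>b. adj a b \<Longrightarrow> s \<noteq> replicate m b"
  shows "\<exists>t. v = a # t \<and> S m s t"
  using assms by (auto elim!: sierp_adj_SucE)

text \<open>A walk of length 3 from an extreme vertex cannot leave its copy. Leaving at
  \<open>z\<close> would make \<open>z'\<close> an extreme vertex \<open>b\<close> with
  \<open>b\<close> adjacent to \<open>a\<close>; all neighbors of that vertex begin with
  \<open>b\<close>, but \<open>y'\<close> begins with \<open>a\<close>.\<close>

lemma sierp_nbhd_replicate:
  assumes "m \<ge> 3" "S m (replicate m a) y" "S m y z" "S m z u"
  shows "\<exists>y' z' u'. y = a # y' \<and> z = a # z' \<and> u = a # u'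
           \<and> S (m - 1) (replicate (m - 1) a) y' \<and> S (m - 1) y' z' \<and> S (m - 1) z' u'"
proof -
  obtain n where m: "m = Suc (Suc (Suc n))"
    using le_Suc_ex[OF assms(1)] by (auto simp: numeral_3_eq_3)
  obtain y' where y': "y = a # y'" "S (m - 1) (replicate (m - 1) a) y'"
    using sierp_adj_replicateD[of "Suc (Suc n)" a y] assms(2) m by auto
  obtain y'' where y'': "y' = a # y''" "S (Suc n) (replicate (Suc n) a) y''"
    using sierp_adj_replicateD[of "Suc n" a y'] y'(2) m by auto
  have ny: "y' \<noteq> replicate (Suc (Suc n)) b" if "adj a b" for b
    using that y''(1) by auto
  obtain z' where z': "z = a # z'" "S (m - 1) y' z'"
    using sierp_adj_not_linkD[OF _ ny, where v = z] assms(3) y'(1) m by auto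
  have nz: "z' \<noteq> replicate (Suc (Suc n)) b" if "adj a b" for b
    using z'(2) that m y'' adj_sym by (auto simp: sierp_adj_Cons)
  obtain u' where "u = a # u'" "S (m - 1) z' u'"
    using sierp_adj_not_linkD[OF _ nz, where v = u] assms(4) z'(1) m by auto
  then show ?thesis using y' z' by blast
qed

text \<open>\<open>Cons a\<close> embeds \<open>S m\<close> into \<open>S (Suc m)\<close>, so
  colorings pull back; this yields the lower bound of the theorem.\<close>

lemma inj_edge_coloring_sierp_Suc:
  assumes "inj_edge_coloring (S (Suc m)) k c" "a \<in> V"
  shows "inj_edge_coloring (S m) k (\<lambda>e. c (Cons a ` e))"
proof (rule inj_edge_coloringI)
  show "c (Cons a ` {x, y}) \<in> {1..k}" if "S m x y" for x y
    using inj_edge_coloring_range[OF assms(1), of "a # x" "a # y"] that assms(2)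
    by (simp add: sierp_adj_Cons)
  show "c (Cons a ` {x, y}) \<noteq> c (Cons a ` {z, u})"
    if "S m x y" "S m y z" "S m z u" "x \<noteq> z" "u \<noteq> y" for x y z u
    using inj_edge_coloringD[OF assms(1), of "a # x" "a # y" "a # z" "a # u"] that assms(2)
    by (simp add: sierp_adj_Cons)
qed

lemma inj_chromatic_index_sierp_mono:
  assumes "finite V" "V \<noteq> {}" "m \<le> n"
  shows "inj_chromatic_index (S m) \<le> inj_chromatic_index (S n)"
  using assms(3)
proof (induction rule: dec_induct)
  case (step n)
  obtain c where "inj_edge_coloring (S (Suc n)) (inj_chromatic_index (S (Suc n))) c"
    using inj_chromatic_index_attained finite_edges_sierp[OF assms(1)] by blast
  then have "inj_chromatic_index (S n) \<le> inj_chromatic_index (S (Suc n))"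
    using assms(2) inj_edge_coloring_sierp_Suc inj_chromatic_index_le by blast
  then show ?case using step.IH by simp
qed simp

text \<open>Two copies are joined by at most one edge, and for \<open>m > 0\<close> a vertex lies on
  at most one joining edge. So a triangle lies inside one copy, where induction applies; for
  \<open>m = 0\<close> it would be a triangle of the base graph. The result excludes the case
  \<open>u = x\<close> for two edges of one monochromatic star.\<close>

lemma sierp_triangle_free:
  assumes "triangle_free adj"
  shows "\<not> (S m x y \<and> S m y z \<and> S m z x)"
proof (induction m arbitrary: x y z)
  case (Suc m)
  show ?case
  proof
    assume E: "S (Suc m) x y \<and> S (Suc m) y z \<and> S (Suc m) z x"
    then obtain a s b t c r where xyz: "x = a # s" "y = b # t" "z = c # r"
      by (metis sierp_adj_length length_Suc_conv)
    have sides: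
      "(a = b \<and> S m s t) \<or> (adj a b \<and> s = replicate m b \<and> t = replicate m a)"
      "(b = c \<and> S m t r) \<or> (adj b c \<and> t = replicate m c \<and> r = replicate m b)"
      "(c = a \<and> S m r s) \<or> (adj c a \<and> r = replicate m a \<and> s = replicate m c)"
      using E xyz by (auto simp: sierp_adj_Cons)
    show False
    proof (cases "m = 0")
      case True
      then have "adj a b" "adj b c" "adj c a" using sides by simp_all
      then show False using assms unfolding triangle_free_def by blast
    next
      case False
      consider "a = b" "b = c" | "a = b" "b \<noteq> c" | "a \<noteq> b" "b = c" | "a \<noteq> b" "b \<noteq> c" by blast
      then show False
      proof cases
        case 1
        then show False using sides Suc.IH[of s t r] by simp
      next
        case 2
        then have "s = t" "S m s t" using sides by simp_all
        then show False by simp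
      next
        case 3
        then have "t = r" "S m t r" using sides by simp_all
        then show False by simp
      next
        case 4
        then have t: "t = replicate m a" "t = replicate m c" using sides(1,2) by simp_all
        then have "a = c" using False by (metis replicate_eq_replicate)
        then have "r = s" "S m r s" using 4 sides by simp_all
        then show False by simp
      qed
    qed
  qed
qed simp

section \<open>Passing from \<open>S m\<close> to \<open>S (Suc m)\<close> with one color for all
  joining edges\<close>

text \<open>\<open>clear_center\<close> allows all edges at the extreme vertex \<open>a\<close> to be recolored with \<open>K\<close>;
  \<open>clear_rim\<close> allows the extreme vertex \<open>b\<close> to be joined to such a monochromatic star by an
  edge of color \<open>K\<close>.\<close>

definition clear_center where
  "clear_center m c K a \<longleftrightarrow> (\<forall>y z u. S m (replicate m a) y \<and> S m y z \<and> z \<noteq> replicate m a \<and> S m z u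
     \<longrightarrow> c {z, u} \<noteq> K)"

definition clear_rim where
  "clear_rim m c K b \<longleftrightarrow> (\<forall>y u. S m (replicate m b) y \<and> S m y u \<longrightarrow> c {y, u} \<noteq> K)"

text \<open>The extreme vertex \<open>a\<close> and its neighbors begin with \<open>a a\<close>,
  whereas an edge from copy \<open>a\<close> to copy \<open>b\<close> leaves at a vertex beginning
  with \<open>a b\<close>. Hence recolored stars at different extreme vertices of one copy do not
  interact.\<close>

lemma sierp_adj_near_replicate:
  assumes "m \<ge> 3" "S m s t" "s = replicate m a \<or> S m (replicate m a) s"
    "t = replicate m b \<or> S m (replicate m b) t"
  shows "a = b"
proof -
  obtain n where m: "m = Suc (Suc (Suc n))"
    using le_Suc_ex[OF assms(1)] by (auto simp: numeral_3_eq_3)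
  have hd2: "\<exists>s''. s = a # a # s''" if "s = replicate m a \<or> S m (replicate m a) s" for s a
    using that
  proof
    assume "S m (replicate m a) s"
    then obtain s' where s': "s = a # s'" "S (Suc (Suc n)) (replicate (Suc (Suc n)) a) s'"
      using sierp_adj_replicateD[of "Suc (Suc n)" a s] m by auto
    then show ?thesis
      using sierp_adj_replicateD[of "Suc n" a s'] by auto
  qed (simp add: m)
  show ?thesis
    using hd2[OF assms(3)] hd2[OF assms(4)] assms(2) m by (auto simp: sierp_adj_Cons)
qed


text \<open>\<open>toward a b\<close> puts the star of the joining edge at
  \<open>b # replicate m a\<close>, that is, at the extreme vertex \<open>a\<close> of copy
  \<open>b\<close>. The other end is the extreme vertex \<open>b\<close> of copy \<open>a\<close>,
  which explains the roles of the two hypotheses on \<open>c\<close>. Both are reproduced for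
  \<open>Suc m\<close> with the same orientation, so the step can be iterated.\<close>

lemma inj_edge_coloring_extend:
  assumes m: "m \<ge> 3" and tf: "triangle_free adj"
    and c: "inj_edge_coloring (S m) K c" and K: "K \<ge> 1"
    and toward: "\<And>a b. adj a b \<Longrightarrow> toward a b \<longleftrightarrow> \<not> toward b a"
    and A: "\<And>a b. adj a b \<Longrightarrow> toward a b \<Longrightarrow> clear_center m c K a"
    and B: "\<And>a b. adj a b \<Longrightarrow> toward a b \<Longrightarrow> clear_rim m c K b"
  shows "\<exists>c'. inj_edge_coloring (S (Suc m)) K c'
    \<and> (\<forall>a b. adj a b \<longrightarrow> toward a b \<longrightarrow> clear_center (Suc m) c' K a)
    \<and> (\<forall>a b. adj a b \<longrightarrow> toward a b \<longrightarrow> clear_rim (Suc m) c' K b)"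
proof -
  define Ctr where "Ctr = {b # replicate m a | a b. adj a b \<and> toward a b}"
  \<comment> \<open>Each joining edge has exactly one end in \<open>Ctr\<close>. An edge that misses
    \<open>Ctr\<close> therefore lies inside one copy, and \<open>tl\<close> turns it into an edge
    of \<open>S m\<close>.\<close>
  define c' where "c' e = (if e \<inter> Ctr \<noteq> {} then K else c (tl ` e))" for e
  have mpos: "0 < m" using m by simp
  have repl_eq: "replicate m a = replicate m b \<longleftrightarrow> a = b" for a b
    using m by (simp add: replicate_eq_replicate)
  have Ctr_iff: "h # t \<in> Ctr \<longleftrightarrow> (\<exists>a. t = replicate m a \<and> adj a h \<and> toward a h)" for h t
    unfolding Ctr_def by auto
  have c'K: "c' e = K" if "v \<in> e" "v \<in> Ctr" for v e
    using that unfolding c'_def by auto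
  have c'in: "c' {h # s, h # t} = c {s, t}" if "h # s \<notin> Ctr" "h # t \<notin> Ctr" for h s t
    using that unfolding c'_def by auto
  have link: "a # replicate m b \<in> Ctr \<longleftrightarrow> b # replicate m a \<notin> Ctr" if "adj a b" for a b
    using that toward[OF that] adj_sym by (auto simp: Ctr_iff mpos)
  \<comment> \<open>An end \<open>y\<close> of a recolored edge lies near an extreme vertex of its copy, which determines
    the centre of the edge.\<close>
  have near: "\<exists>h t d. y = h # t \<and> (t = replicate m d \<or> S m (replicate m d) t) \<and> adj h d \<and>
      p = (if toward d h then h # replicate m d else d # replicate m h) \<and>
      (toward d h \<or> t = replicate m d)"
    if E: "S (Suc m) x y" and p: "p \<in> {x, y}" "p \<in> Ctr" for x y p
    using E
  proof (cases rule: sierp_adj_SucE)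
    case (inner h s t)
    obtain s' where s': "p = h # s'" "s' \<in> {s, t}" using inner p(1) by auto
    then obtain a where a: "s' = replicate m a" "adj a h" "toward a h"
      using p(2) by (auto simp: Ctr_iff)
    show ?thesis
      using inner s' a by (intro exI[of _ h] exI[of _ t] exI[of _ a]) (auto simp: adj_sym sierp_adj_sym)
  next
    case (link g h)
    have "p = (if toward g h then h # replicate m g else g # replicate m h)"
      using p link toward[OF link(3)] by (auto simp: Ctr_iff mpos)
    then show ?thesis
      using link by (intro exI[of _ h] exI[of _ "replicate m g"] exI[of _ g]) (auto simp: adj_sym)
  qed
  \<comment> \<open>If \<open>y\<close> and \<open>z\<close> are in one copy,
    \<open>sierp_adj_near_replicate\<close> identifies the extreme vertices they are near. Otherwise
    they are the two ends of one joining edge, which has a single centre.\<close>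
  have same: "p = r"
    if E: "S (Suc m) x y" "S (Suc m) y z" "S (Suc m) z u" and p: "p \<in> {x, y}" "p \<in> Ctr" and r: "r \<in> {z, u}" "r \<in> Ctr"
    for x y z u p r
  proof -
    obtain h t d where y: "y = h # t" "t = replicate m d \<or> S m (replicate m d) t" "adj h d"
      "p = (if toward d h then h # replicate m d else d # replicate m h)"
      using near[OF E(1) p] by blast
    have "r \<in> {u, z}" using r(1) by auto
    then obtain g s e where z: "z = g # s" "s = replicate m e \<or> S m (replicate m e) s" "adj g e"
      "r = (if toward e g then g # replicate m e else e # replicate m g)"
      using near[OF sierp_adj_sym[OF E(3)] _ r(2)] by blast
    show ?thesis
    proof (cases "g = h")
      case True
      then have "S m t s" using E(2) y z by (simp add: sierp_adj_Cons)
      then have "d = e" using sierp_adj_near_replicate[OF m _ y(2) z(2)] by blast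
      then show ?thesis using True y z by simp
    next
      case False
      then have hg: "adj h g" "t = replicate m g" "s = replicate m h"
        using E(2) y z by (auto simp: sierp_adj_Cons)
      have "\<not> S m (replicate m a) (replicate m b)" for a b
        using sierp_adj_near_replicate[OF m, of "replicate m a" "replicate m b" a b] by auto
      then have "d = g" "e = h" using y z hg repl_eq by auto
      then show ?thesis using y z hg toward[OF hg(1)] by auto
    qed
  qed
  \<comment> \<open>If \<open>y\<close> and \<open>z\<close> share a copy, the centre is either in
    that copy, where \<open>clear_center\<close> applies, or across a joining edge that ends at
    \<open>y\<close>, where \<open>clear_rim\<close> applies. If \<open>yz\<close> is itself a
    joining edge, its centre is \<open>y\<close>, and \<open>clear_rim\<close> applies at
    \<open>z\<close>.\<close>
  have star: "c' {z, u} \<noteq> K"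
    if E: "S (Suc m) x y" "S (Suc m) y z" "S (Suc m) z u" and ne: "x \<noteq> z" "u \<noteq> y"
      and p: "p \<in> {x, y}" "p \<in> Ctr" and n: "{z, u} \<inter> Ctr = {}" for x y z u p
  proof -
    obtain h t d where y: "y = h # t" "t = replicate m d \<or> S m (replicate m d) t" "adj h d"
      "p = (if toward d h then h # replicate m d else d # replicate m h)" "toward d h \<or> t = replicate m d"
      using near[OF E(1) p] by blast
    obtain g z' u' where zu: "z = g # z'" "u = g # u'" "S m z' u'"
      using E(3) n link by (auto elim!: sierp_adj_SucE)
    have cc: "c' {z, u} = c {z', u'}" using zu n c'in by auto
    show ?thesis
    proof (cases "g = h")
      case True
      then have tz: "S m t z'" using E(2) y zu by (simp add: sierp_adj_Cons)
      show ?thesis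
      proof (cases "toward d h")
        case True
        then have nz: "z' \<noteq> replicate m d" "u' \<noteq> replicate m d"
          using \<open>g = h\<close> p y n zu by auto
        have cl: "clear_center m c K d" using A[OF adj_sym[OF y(3)] True] .
        from y(2) show ?thesis
        proof
          assume "t = replicate m d"
          then have "c {u', z'} \<noteq> K"
            using cl tz zu(3) nz sierp_adj_sym unfolding clear_center_def by blast
          then show ?thesis by (metis cc insert_commute)
        next
          assume "S m (replicate m d) t"
          then show ?thesis
            using cl tz zu(3) nz unfolding clear_center_def cc by blast
        qed
      next
        case False
        then have "t = replicate m d" "toward h d" using y toward by auto
        then show ?thesis
          using B[OF y(3)] tz zu(3) unfolding clear_rim_def cc by blast
      qed
    next
      case False
      then have hg: "adj h g" "t = replicate m g" "z' = replicate m h"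
        using E(2) y zu by (auto simp: sierp_adj_Cons)
      have "g # replicate m h \<notin> Ctr" using n zu hg by auto
      then have "toward g h" using hg(1) toward[OF hg(1)] adj_sym by (auto simp: Ctr_iff)
      then have "clear_rim m c K h" using B adj_sym[OF hg(1)] by blast
      then have "c {u', z'} \<noteq> K"
        using zu(3) hg sierp_adj_sym unfolding clear_rim_def by blast
      then show ?thesis by (metis cc insert_commute)
    qed
  qed
  have col: "inj_edge_coloring (S (Suc m)) K c'"
  proof (rule inj_edge_coloringI)
    fix x y assume xy: "S (Suc m) x y"
    show "c' {x, y} \<in> {1..K}"
    proof (cases "{x, y} \<inter> Ctr = {}")
      case True
      then obtain h s t where "x = h # s" "y = h # t" "S m s t"
        using xy link by (auto elim!: sierp_adj_SucE)
      then show ?thesis using True c'in inj_edge_coloring_range[OF c] by auto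
    next
      case False
      then show ?thesis using K by (simp add: c'_def)
    qed
  next
    fix x y z u
    assume E: "S (Suc m) x y" "S (Suc m) y z" "S (Suc m) z u" and ne: "x \<noteq> z" "u \<noteq> y"
    consider (both) p r where "p \<in> {x, y}" "p \<in> Ctr" "r \<in> {z, u}" "r \<in> Ctr"
      | (left) p where "p \<in> {x, y}" "p \<in> Ctr" "{z, u} \<inter> Ctr = {}"
      | (right) r where "r \<in> {u, z}" "r \<in> Ctr" "{y, x} \<inter> Ctr = {}"
      | (none) "{x, y} \<inter> Ctr = {}" "{z, u} \<inter> Ctr = {}"
      by blast
    then show "c' {x, y} \<noteq> c' {z, u}"
    proof cases
      case both
      then have "p = r" using same[OF E] by blast
      \<comment> \<open>The common centre of the two edges can only be \<open>x = u\<close>, so the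
        walk closes to a triangle.\<close>
      then have "u = x" using both ne E sierp_adj_irrefl by auto
      then show ?thesis using E sierp_triangle_free[OF tf] by blast
    next
      case left
      then show ?thesis using star[OF E ne left] c'K[OF left(1,2)] by simp
    next
      case right
      have "c' {y, x} \<noteq> K"
        using star[OF sierp_adj_sym[OF E(3)] sierp_adj_sym[OF E(2)] sierp_adj_sym[OF E(1)] ne(2,1) right] .
      then show ?thesis using c'K[OF right(1,2)] by (metis insert_commute)
    next
      case none
      obtain h x' y' where xy: "x = h # x'" "y = h # y'" "S m x' y'"
        using E(1) none(1) link by (auto elim!: sierp_adj_SucE)
      obtain g z' u' where zu: "z = g # z'" "u = g # u'" "S m z' u'"
        using E(3) none(2) link by (auto elim!: sierp_adj_SucE)
      have "g = h" "S m y' z'"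
        using E(2) none xy zu link by (auto simp: sierp_adj_Cons)
      then show ?thesis
        using inj_edge_coloringD[OF c _ xy(3) _ zu(3)] xy zu ne none c'in by auto
    qed
  qed
  \<comment> \<open>A centre begins with two adjacent, hence different, letters. So edges between
    vertices beginning with \<open>a a\<close> keep their color, and the clear conditions survive
    around the extreme vertices of \<open>S (Suc m)\<close>.\<close>
  have away: "c' {v, w} = c {v', w'}"
    if "v = a # v'" "w = a # w'" "v' = a # v''" "w' = a # w''" for a v w v' w' v'' w''
  proof -
    have "hd v' \<noteq> b" if "adj b a" for b using that \<open>v' = a # v''\<close> by auto
    moreover have "hd w' \<noteq> b" if "adj b a" for b using that \<open>w' = a # w''\<close> by auto
    moreover have "hd (replicate m b) = b" for b using m by (cases m) auto
    ultimately show ?thesis using that c'in by (metis Ctr_iff)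
  qed
  have center: "clear_center (Suc m) c' K a" if "clear_center m c K a" for a
    unfolding clear_center_def
  proof (intro allI impI, elim conjE)
    fix y z u
    assume *: "S (Suc m) (replicate (Suc m) a) y" "S (Suc m) y z" "z \<noteq> replicate (Suc m) a" "S (Suc m) z u"
    obtain y' z' u' where 1: "y = a # y'" "z = a # z'" "u = a # u'"
      "S m (replicate m a) y'" "S m y' z'" "S m z' u'"
      using sierp_nbhd_replicate[OF _ *(1,2,4)] m by auto
    obtain z'' u'' where 2: "z' = a # z''" "u' = a # u''"
      using sierp_nbhd_replicate[OF m 1(4,5,6)] by blast
    have "c {z', u'} \<noteq> K"
      using that 1 *(3) unfolding clear_center_def by (metis replicate_Suc)
    then show "c' {z, u} \<noteq> K" using away[OF 1(2,3) 2] by simp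
  qed
  have rim: "clear_rim (Suc m) c' K b" if "clear_rim m c K b" for b
    unfolding clear_rim_def
  proof (intro allI impI, elim conjE)
    fix y u
    assume *: "S (Suc m) (replicate (Suc m) b) y" "S (Suc m) y u"
    obtain y' u' where 1: "y = b # y'" "u = b # u'" "S m (replicate m b) y'" "S m y' u'"
      using sierp_nbhd_replicate[OF _ * sierp_adj_sym[OF *(2)]] m by auto
    obtain y'' u'' where 2: "y' = b # y''" "u' = b # u''"
      using sierp_nbhd_replicate[OF m 1(3,4) sierp_adj_sym[OF 1(4)]] by blast
    have "c {y', u'} \<noteq> K" using that 1 unfolding clear_rim_def by blast
    then show "c' {y, u} \<noteq> K" using away[OF 1(1,2) 2] by simp
  qed
  show ?thesis
    using col center[OF A] rim[OF B] by (intro exI[of _ c'] conjI allI impI)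
qed

lemma inj_chromatic_index_sierp_le:
  assumes "n \<ge> 3" and tf: "triangle_free adj"
    and c: "inj_edge_coloring (S 3) K c" and K: "K \<ge> 1"
    and toward: "\<And>a b. adj a b \<Longrightarrow> toward a b \<longleftrightarrow> \<not> toward b a"
    and A: "\<And>a b. adj a b \<Longrightarrow> toward a b \<Longrightarrow> clear_center 3 c K a"
    and B: "\<And>a b. adj a b \<Longrightarrow> toward a b \<Longrightarrow> clear_rim 3 c K b"
  shows "inj_chromatic_index (S n) \<le> K"
proof -
  have "\<exists>c. inj_edge_coloring (S n) K c
    \<and> (\<forall>a b. adj a b \<longrightarrow> toward a b \<longrightarrow> clear_center n c K a)
    \<and> (\<forall>a b. adj a b \<longrightarrow> toward a b \<longrightarrow> clear_rim n c K b)"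
    using assms(1)
  proof (induction rule: dec_induct)
    case base
    then show ?case using c A B by blast
  next
    case (step m)
    then obtain d where d: "inj_edge_coloring (S m) K d"
      "\<And>a b. adj a b \<Longrightarrow> toward a b \<Longrightarrow> clear_center m d K a"
      "\<And>a b. adj a b \<Longrightarrow> toward a b \<Longrightarrow> clear_rim m d K b" by blast
    show ?case by (rule inj_edge_coloring_extend[OF step.hyps(1) tf d(1) K toward d(2,3)])
  qed
  then show ?thesis using inj_chromatic_index_le by blast
qed


section \<open>Adjacency in \<open>S 2\<close> and \<open>S 3\<close>, and recoloring
  \<open>S 2\<close> at a pendant vertex\<close>

lemma sierp_adj_2:
  "S 2 [p, q] [r, t] \<longleftrightarrow> (p = r \<and> p \<in> V \<and> adj q t) \<or> (adj p r \<and> q = r \<and> t = p)"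
  by (simp add: numeral_2_eq_2 sierp_adj_Cons adj_V)

lemma sierp_adj_2E:
  assumes "S 2 v w"
  obtains p q r t where "v = [p, q]" "w = [r, t]" "(p = r \<and> p \<in> V \<and> adj q t) \<or> (adj p r \<and> q = r \<and> t = p)"
proof -
  obtain p q r t where "v = [p, q]" "w = [r, t]"
    using sierp_adj_length[OF assms] by (auto simp: numeral_2_eq_2 length_Suc_conv)
  then show ?thesis using assms that by (simp add: sierp_adj_2)
qed

lemma sierp_adj_3:
  "S 3 (x # s) (y # t) \<longleftrightarrow>
     (x = y \<and> x \<in> V \<and> S 2 s t) \<or> (adj x y \<and> s = [y, y] \<and> t = [x, x])"
  using sierp_adj_Cons[of 2 x s y t] by (simp add: numeral_2_eq_2 numeral_3_eq_3)

lemma sierp_adj_3E: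
  assumes "S 3 v w"
  obtains (inner) x s t where "v = x # s" "w = x # t" "x \<in> V" "S 2 s t"
  | (link) x y where "v = [x, y, y]" "w = [y, x, x]" "adj x y"
  using assms sierp_adj_SucE[of 2 v w] by (simp add: numeral_2_eq_2 numeral_3_eq_3) blast

text \<open>In copy \<open>a\<close> of \<open>G\<close>, everything except the pendant vertex is attached at \<open>[a, b]\<close> only. It is colored
  like copy \<open>b\<close>; swapping the colors \<open>i\<close>, \<open>j\<close> of the path \<open>[b, b]\<close>, \<open>[b, a]\<close>, \<open>[a, b]\<close> compensates for
  this path being traversed from its other end.\<close>

lemma pendant_recolor_2:
  assumes c: "inj_edge_coloring (S 2) K c" and K: "K \<ge> 1"
    and rim: "\<And>y u. S 2 [b, b] y \<Longrightarrow> S 2 y u \<Longrightarrow> c {y, u} \<noteq> K"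
    and N: "\<And>x. adj a x \<longleftrightarrow> x = b"
  obtains d where "inj_edge_coloring (S 2) K d" "d {[a, a], [a, b]} = K"
    "\<And>t. S 2 [a, b] t \<Longrightarrow> t \<noteq> [a, a] \<Longrightarrow> d {[a, b], t} \<noteq> K"
    "\<And>s t. S 2 s t \<Longrightarrow> hd s \<noteq> a \<or> hd t \<noteq> a \<Longrightarrow> d {s, t} = c {s, t}"
proof -
  define i j where "i = c {[b, b], [b, a]}" and "j = c {[b, a], [a, b]}"
  define sw where "sw = id(i := j, j := i)"
  define d where "d e = (if hd ` e = {a} then if [a, a] \<in> e then K else sw (c ((\<lambda>v. b # tl v) ` e)) else c e)"
    for e
  have ab: "adj a b" "adj b a" "a \<in> V" "b \<in> V" "a \<noteq> b" "b \<noteq> a"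
    using N[of b] adj_sym adj_V by auto
  have Na: "adj x a \<longleftrightarrow> x = b" for x using N adj_sym by metis
  have [simp]: "sw x = sw y \<longleftrightarrow> x = y" for x y by (auto simp: sw_def)
  have sw_ij: "sw i = j" "sw j = i" by (auto simp: sw_def)
  \<comment> \<open>By \<open>rim\<close>, neither swapped color is \<open>K\<close>, so the swap
    preserves the set of edges colored \<open>K\<close>.\<close>
  have i: "i \<in> {1..K}" "i \<noteq> K"
    using inj_edge_coloring_range[OF c, of "[b, b]" "[b, a]"] rim[of "[b, a]" "[b, b]"] ab
    by (auto simp: i_def sierp_adj_2 insert_commute)
  have j: "j \<in> {1..K}" "j \<noteq> K"
    using inj_edge_coloring_range[OF c, of "[b, a]" "[a, b]"] rim[of "[b, a]" "[a, b]"] ab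
    by (auto simp: j_def sierp_adj_2)
  have sw_K: "sw x = K \<longleftrightarrow> x = K" for x using i j by (auto simp: sw_def)
  have sw_range: "sw x \<in> {1..K}" if "x \<in> {1..K}" for x using that i j by (auto simp: sw_def)
  have d_star: "d {[a, a], [a, x]} = K" "d {[a, x], [a, a]} = K" for x by (auto simp: d_def)
  have d_in: "d {[a, x], [a, y]} = sw (c {[b, x], [b, y]})" if "x \<noteq> a" "y \<noteq> a" for x y
    using that by (auto simp: d_def)
  have d_out: "d {s, t} = c {s, t}" if "hd s \<noteq> a \<or> hd t \<noteq> a" for s t
    using that by (auto simp: d_def)
  have cD: "c {x, y} \<noteq> c {z, u}"
    if "S 2 x y" "S 2 y z" "S 2 z u" "x \<noteq> z" "u \<noteq> y" for x y z u
    using inj_edge_coloringD[OF c] that by simp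
  \<comment> \<open>Copy \<open>a\<close> can be left only through the bridge from
    \<open>[a, b]\<close> to \<open>[b, a]\<close>, so \<open>zu\<close> is the bridge, of color
    \<open>j\<close>, or the edge from \<open>[b, a]\<close> to \<open>[b, b]\<close>, of color
    \<open>i\<close>. In copy \<open>b\<close> the mirrored walk starts from \<open>[b, b]\<close>
    and meets these two edges in the opposite order; the swap turns its constraint into the required
    one.\<close>
  have half: "d {[a, x], [a, y]} \<noteq> d {z, u}"
    if E: "adj x y" "S 2 [a, y] z" "S 2 z u" "[a, x] \<noteq> z" "u \<noteq> [a, y]" "hd z \<noteq> a \<or> hd u \<noteq> a" for x y z u
  proof (cases "hd z = a")
    case True
    then have z: "z = [a, b]" "u = [b, a]" "adj y b"
      using E(2,3,6) by (auto elim!: sierp_adj_2E simp: N)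
    have y: "y \<noteq> a" using E(1,4) z Na by auto
    have x: "x \<noteq> a" using E(1) z(3) N by auto
    have "c {[b, x], [b, y]} \<noteq> i"
      unfolding i_def using cD[of "[b, x]" "[b, y]" "[b, b]" "[b, a]"] E z ab y by (auto simp: sierp_adj_2)
    then have "sw (c {[b, x], [b, y]}) \<noteq> j" using sw_ij by (metis \<open>\<And>y x. (sw x = sw y) = (x = y)\<close>)
    then show ?thesis
      using z x y ab d_in[of x y] d_out[of "[a, b]" "[b, a]"] by (simp add: j_def insert_commute)
  next
    case False
    then have z: "z = [b, a]" "y = b"
      using E(2) by (auto elim!: sierp_adj_2E simp: N)
    then have u: "u = [b, b]"
      using E(3,5) by (auto elim!: sierp_adj_2E simp: N Na)
    have zu: "d {z, u} = i" using z u ab d_out by (simp add: i_def insert_commute)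
    show ?thesis
    proof (cases "x = a")
      case True
      then show ?thesis using zu i d_star by auto
    next
      case False
      have "c {[b, x], [b, b]} \<noteq> j"
        unfolding j_def using cD[of "[b, x]" "[b, b]" "[b, a]" "[a, b]"] E(1) z ab False
        by (auto simp: sierp_adj_2)
      then have "sw (c {[b, x], [b, y]}) \<noteq> i"
        using sw_ij z by (metis \<open>\<And>y x. (sw x = sw y) = (x = y)\<close>)
      then show ?thesis using d_in[of x y] False z ab zu by simp
    qed
  qed
  have "inj_edge_coloring (S 2) K d"
  proof (rule inj_edge_coloringI)
    fix v w assume vw: "S 2 v w"
    show "d {v, w} \<in> {1..K}"
    proof (cases "hd v = a \<and> hd w = a")
      case True
      then obtain x y where xy: "v = [a, x]" "w = [a, y]" "adj x y"
        using vw by (auto elim!: sierp_adj_2E)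
      show ?thesis
      proof (cases "x = a \<or> y = a")
        case True
        then show ?thesis using xy d_star K by auto
      next
        case False
        then show ?thesis
          using xy d_in sw_range inj_edge_coloring_range[OF c, of "[b, x]" "[b, y]"] ab
          by (auto simp: sierp_adj_2)
      qed
    next
      case False
      then show ?thesis using d_out inj_edge_coloring_range[OF c vw] by auto
    qed
  next
    fix x y z u
    assume E: "S 2 x y" "S 2 y z" "S 2 z u" and ne: "x \<noteq> z" "u \<noteq> y"
    consider (out) "hd x \<noteq> a \<or> hd y \<noteq> a" "hd z \<noteq> a \<or> hd u \<noteq> a"
      | (left) "hd x = a" "hd y = a" "hd z \<noteq> a \<or> hd u \<noteq> a"
      | (right) "hd z = a" "hd u = a" "hd x \<noteq> a \<or> hd y \<noteq> a"
      | (both) "hd x = a" "hd y = a" "hd z = a" "hd u = a"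
      by blast
    then show "d {x, y} \<noteq> d {z, u}"
    proof cases
      case out
      then show ?thesis using d_out cD[OF E ne] by metis
    next
      case left
      then obtain p q where "x = [a, p]" "y = [a, q]" "adj p q"
        using E(1) by (auto elim!: sierp_adj_2E)
      then show ?thesis using half[of p q z u] E ne left by auto
    next
      case right
      then obtain p q where "u = [a, p]" "z = [a, q]" "adj p q"
        using E(3) adj_sym by (auto elim!: sierp_adj_2E)
      then have "d {u, z} \<noteq> d {y, x}"
        using half[of p q y x] E[THEN sierp_adj_sym] ne right by auto
      then show ?thesis by (simp add: insert_commute)
    next
      case both
      obtain p q where xy: "x = [a, p]" "y = [a, q]" "adj p q"
        using E(1) both by (auto elim!: sierp_adj_2E)
      obtain r t where zu: "z = [a, r]" "u = [a, t]" "adj r t"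
        using E(3) both by (auto elim!: sierp_adj_2E)
      have qr: "adj q r" using E(2) xy zu by (auto simp: sierp_adj_2)
      have q: "q \<noteq> a" "r \<noteq> a" using xy zu qr ne N Na by auto
      have "\<not> (p = a \<and> t = a)" using xy zu qr N Na by (metis adj_irrefl)
      then consider "p = a" "t \<noteq> a" | "p \<noteq> a" "t = a" | "p \<noteq> a" "t \<noteq> a"
        by blast
      then show ?thesis
      proof cases
        case 1
        \<comment> \<open>The edge at \<open>[a, a]\<close> has color \<open>K\<close>. The mirror
          image of the other edge starts at a neighbor of \<open>[b, b]\<close>, where
          \<open>rim\<close> excludes \<open>K\<close>.\<close>
        then have "q = b" using xy N by simp
        then have "c {[b, r], [b, t]} \<noteq> K"
          using rim[of "[b, r]" "[b, t]"] qr zu ab by (simp add: sierp_adj_2)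
        then show ?thesis using 1 xy zu q d_star d_in sw_K by metis
      next
        case 2
        then have "r = b" using zu Na by simp
        then have "c {[b, q], [b, p]} \<noteq> K"
          using rim[of "[b, q]" "[b, p]"] qr xy ab adj_sym by (simp add: sierp_adj_2)
        then show ?thesis using 2 xy zu q d_star d_in[of q p] sw_K by (metis insert_commute)
      next
        case 3
        have "c {[b, p], [b, q]} \<noteq> c {[b, r], [b, t]}"
          using cD[of "[b, p]" "[b, q]" "[b, r]" "[b, t]"] xy zu qr ne ab by (simp add: sierp_adj_2)
        then show ?thesis using 3 xy zu q d_in by simp
      qed
    qed
  qed
  moreover have "d {[a, b], t} \<noteq> K" if t: "S 2 [a, b] t" "t \<noteq> [a, a]" for t
  proof (cases "hd t = a")
    case True
    then obtain y where y: "t = [a, y]" "adj b y" using t(1) by (auto elim!: sierp_adj_2E)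
    then have "c {[b, y], [b, b]} \<noteq> K"
      using rim[of "[b, y]" "[b, b]"] ab adj_sym by (simp add: sierp_adj_2)
    then show ?thesis using y t ab d_in[of b y] sw_K by (simp add: insert_commute)
  next
    case False
    then have "t = [b, a]" using t(1) by (auto elim!: sierp_adj_2E simp: N)
    then show ?thesis using j d_out ab by (simp add: j_def insert_commute)
  qed
  ultimately show ?thesis using that d_star d_out by blast
qed


section \<open>Colorings of \<open>S 3\<close> under hypothesis (ii)\<close>

definition star_coloring where
  "star_coloring K A B c \<longleftrightarrow> inj_edge_coloring (S 3) K c
     \<and> (\<forall>u\<in>A. \<forall>y. S 3 [u, u, u] y \<longrightarrow> c {[u, u, u], y} = K)
     \<and> (\<forall>v\<in>B. clear_rim 3 c K v)"

lemma replicate_3: "replicate 3 x = [x, x, x]"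
  by (simp add: numeral_3_eq_3)

lemma sierp_nbhd_3:
  assumes "S 3 [a, a, a] y" "S 3 y z" "S 3 z u"
  obtains y' z' u' where "y = a # y'" "z = a # z'" "u = a # u'"
    "S 2 [a, a] y'" "S 2 y' z'" "S 2 z' u'"
  using sierp_nbhd_replicate[of 3 a y z u] assms that
  by (auto simp: numeral_2_eq_2 numeral_3_eq_3)

text \<open>Let \<open>y\<close> be a neighbor of the extreme vertex \<open>a\<close>. An edge
  \<open>zu\<close> with \<open>u\<close> different from \<open>y\<close> conflicts with the
  \<open>K\<close>-colored edge from the extreme vertex to \<open>y\<close>. An edge
  \<open>zy\<close> conflicts with a second edge at the extreme vertex, which exists unless
  \<open>a\<close> is pendant.\<close>

lemma clear_center_if_star_coloring:
  assumes c: "star_coloring K A B c" and a: "a \<in> A"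
    and pendant: "\<And>b t. (\<And>x. adj a x \<longleftrightarrow> x = b) \<Longrightarrow> S 3 [a, a, b] t \<Longrightarrow> t \<noteq> [a, a, a]
      \<Longrightarrow> c {[a, a, b], t} \<noteq> K"
  shows "clear_center 3 c K a"
  unfolding clear_center_def
proof (intro allI impI, elim conjE)
  fix y z u
  assume "S 3 (replicate 3 a) y" "S 3 y z" "z \<noteq> replicate 3 a" "S 3 z u"
  then have E: "S 3 [a, a, a] y" "S 3 y z" "S 3 z u" and z: "z \<noteq> [a, a, a]"
    by (simp_all add: numeral_3_eq_3)
  have c3: "inj_edge_coloring (S 3) K c" and cK: "\<And>y. S 3 [a, a, a] y \<Longrightarrow> c {[a, a, a], y} = K"
    using c a unfolding star_coloring_def by auto
  note cD = inj_edge_coloringD[OF c3 sierp_adj_irrefl]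
  obtain y' where y': "y = a # y'" "S 2 [a, a] y'"
    using sierp_nbhd_3[OF E] by metis
  then obtain b where b: "y = [a, a, b]" "adj a b"
    by (auto elim!: sierp_adj_2E)
  show "c {z, u} \<noteq> K"
  proof (cases "u = y")
    case False
    then show ?thesis using cD[OF E] z cK[OF E(1)] by auto
  next
    case u: True
    have "c {y, z} \<noteq> K"
    proof (cases "\<forall>x. adj a x \<longleftrightarrow> x = b")
      case True
      then show ?thesis using pendant[of b z] b E(2) z by auto
    next
      case False
      then obtain x where x: "adj a x" "x \<noteq> b" using b by auto
      then have 1: "S 3 [a, a, a] [a, a, x]" by (simp add: sierp_adj_3 sierp_adj_2 adj_V)
      have "c {[a, a, x], [a, a, a]} \<noteq> c {y, z}"
        using cD[OF sierp_adj_sym[OF 1] E(1,2)] z x b by auto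
      then show ?thesis using cK[OF 1] by (simp add: insert_commute)
    qed
    then show ?thesis using u by (simp add: insert_commute)
  qed
qed

text \<open>Copy \<open>a\<close> of \<open>S 3\<close> is attached only through the bridge from
  \<open>[a, b, b]\<close> to \<open>[b, a, a]\<close>. Copies \<open>a\<close> and \<open>b\<close>
  both receive the coloring from \<open>pendant_recolor_2\<close>, and the bridge receives
  \<open>K\<close>. The last conclusion allows pendant vertices to be treated one after
  another.\<close>

lemma pendant_recolor:
  assumes c: "star_coloring K A B c" and K: "K \<ge> 1" and AB: "A \<inter> B = {}"
    and a: "a \<in> A" "b \<in> B" and N: "\<And>x. adj a x \<longleftrightarrow> x = b"
  obtains c' where "star_coloring K A B c'" "clear_center 3 c' K a"
    "\<And>u. u \<in> A \<Longrightarrow> clear_center 3 c K u \<Longrightarrow> clear_center 3 c' K u"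
proof -
  have ab: "adj a b" "adj b a" "a \<in> V" "b \<in> V" "a \<noteq> b" "b \<noteq> a"
    using N[of b] adj_sym adj_V by auto
  have Na: "adj x a \<longleftrightarrow> x = b" for x using N adj_sym by metis
  have c3: "inj_edge_coloring (S 3) K c"
    and cK: "\<And>u y. u \<in> A \<Longrightarrow> S 3 [u, u, u] y \<Longrightarrow> c {[u, u, u], y} = K"
    and cB: "\<And>v. v \<in> B \<Longrightarrow> clear_rim 3 c K v"
    using c unfolding star_coloring_def by auto
  define cb where "cb e = c (Cons b ` e)" for e
  have cb: "inj_edge_coloring (S 2) K cb"
    using inj_edge_coloring_sierp_Suc[of 2 K c b] c3 ab
    unfolding cb_def by (simp add: numeral_2_eq_2 numeral_3_eq_3)
  have rim: "cb {y, u} \<noteq> K" if "S 2 [b, b] y" "S 2 y u" for y u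
  proof -
    have "S 3 (replicate 3 b) (b # y)" "S 3 (b # y) (b # u)"
      using that ab sierp_adj_3[of b "[b, b]"] sierp_adj_3[of b y] by (simp_all add: replicate_3)
    then show ?thesis using cB[OF a(2)] unfolding clear_rim_def cb_def by auto
  qed
  obtain d where d: "inj_edge_coloring (S 2) K d" "d {[a, a], [a, b]} = K"
    "\<And>t. S 2 [a, b] t \<Longrightarrow> t \<noteq> [a, a] \<Longrightarrow> d {[a, b], t} \<noteq> K"
    "\<And>s t. S 2 s t \<Longrightarrow> hd s \<noteq> a \<or> hd t \<noteq> a \<Longrightarrow> d {s, t} = cb {s, t}"
    using pendant_recolor_2[OF cb K rim N] by blast
  define c' where "c' e = (if hd ` e = {a} \<or> hd ` e = {b} then d (tl ` e)
    else if hd ` e = {a, b} then K else c e)" for e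
  have c'_d: "c' {h # s, h # t} = d {s, t}" if "h = a \<or> h = b" for h s t
    using that by (auto simp: c'_def)
  have c'_c: "c' {h # s, h # t} = c {h # s, h # t}" if "h \<noteq> a" "h \<noteq> b" for h s t
    using that ab by (auto simp: c'_def doubleton_eq_iff)
  have c'_b: "c' {b # s, b # t} = c {b # s, b # t}" if "S 2 s t" "hd s \<noteq> a \<or> hd t \<noteq> a" for s t
    using c'_d d(4)[OF that] by (simp add: cb_def)
  have c'_K: "c' {a # s, b # t} = K" "c' {b # s, a # t} = K" for s t
    using ab by (auto simp: c'_def doubleton_eq_iff)
  have c'_link: "c' {g # s, h # t} = c {g # s, h # t}" if "adj g h" "g \<noteq> a" "h \<noteq> a" for g h s t
    using that ab by (auto simp: c'_def doubleton_eq_iff)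
  note cD = inj_edge_coloringD[OF c3 sierp_adj_irrefl]
  \<comment> \<open>In copy \<open>b\<close> only edges with both tails beginning with
    \<open>a\<close> change. A joining edge other than the bridge meets copy \<open>b\<close> at a
    tail \<open>[h, h]\<close> with \<open>h\<close> different from \<open>a\<close>, so nothing
    changes near it.\<close>
  have corner: "c' {g # s, g # t} = c {g # s, g # t}"
    if "adj g h" "g \<noteq> a" "h \<noteq> a" "S 2 [h, h] s" "S 2 s t" for g h s t
  proof (cases "g = b")
    case True
    have "hd s = h" using that(4) by (auto elim!: sierp_adj_2E)
    then show ?thesis using True c'_b[OF that(5)] that by auto
  next
    case False
    then show ?thesis using c'_c that by auto
  qed
  have link_inner: "c' {v, w} \<noteq> c' {z, u}"
    if E: "S 3 v w" "S 3 w z" "S 3 z u" and ne: "v \<noteq> z" "u \<noteq> w" and hds: "hd v \<noteq> hd w" "hd z = hd u"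
    for v w z u
  proof -
    obtain g h where vw: "v = [g, h, h]" "w = [h, g, g]" "adj g h"
      using E(1) hds(1) by (auto elim!: sierp_adj_3E)
    obtain s where z: "z = h # s" "S 2 [g, g] s"
      using E(2) vw ne(1) by (auto elim!: sierp_adj_3E)
    obtain t where u: "u = h # t" "S 2 s t"
      using E(3) z hds(2) by (auto elim!: sierp_adj_3E)
    show ?thesis
    proof (cases "g = a \<or> h = a")
      case True
      \<comment> \<open>Crossing the bridge into copy \<open>b\<close> leads to
        \<open>[b, a, b]\<close>, whose other edges avoid \<open>K\<close> by the choice of
        \<open>d\<close>. Crossing into copy \<open>a\<close> leads to a neighbor of
        \<open>[a, b, b]\<close>, where \<open>rim\<close> excludes \<open>K\<close>.\<close>
      then consider "g = a" "h = b" | "g = b" "h = a" using vw N Na by auto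
      then show ?thesis
      proof cases
        case 1
        then have "s = [a, b]" using z by (auto elim!: sierp_adj_2E simp: N)
        then have "d {s, t} \<noteq> K" using d(3)[of t] u vw ne 1 by auto
        then show ?thesis using 1 vw z u c'_K c'_d by simp
      next
        case 2
        have "hd s = b" using z 2 by (auto elim!: sierp_adj_2E)
        then have "d {s, t} = cb {s, t}" using d(4)[OF u(2)] ab by simp
        then have "d {s, t} \<noteq> K" using rim[of s t] z u 2 by simp
        then show ?thesis using 2 vw z u c'_K c'_d by simp
      qed
    next
      case False
      then have "c' {z, u} = c {z, u}"
        using corner[OF adj_sym[OF vw(3)] _ _ z(2) u(2)] z u by simp
      moreover have "c' {v, w} = c {v, w}" using False c'_link vw by simp
      ultimately show ?thesis using cD[OF E ne] by simp
    qed
  qed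
  have "inj_edge_coloring (S 3) K c'"
  proof (rule inj_edge_coloringI)
    fix v w assume vw: "S 3 v w"
    then show "c' {v, w} \<in> {1..K}"
    proof (cases rule: sierp_adj_3E)
      case (inner h s t)
      then show ?thesis
        using c'_d c'_c inj_edge_coloring_range[OF c3 vw] inj_edge_coloring_range[OF d(1), of s t]
        by (cases "h = a \<or> h = b") auto
    next
      case (link g h)
      then show ?thesis
        using c'_K c'_link K inj_edge_coloring_range[OF c3 vw] N Na
        by (cases "g = a \<or> h = a") auto
    qed
  next
    fix v w z u
    assume E: "S 3 v w" "S 3 w z" "S 3 z u" and ne: "v \<noteq> z" "u \<noteq> w"
    consider (LL) "hd v \<noteq> hd w" "hd z \<noteq> hd u" | (LI) "hd v \<noteq> hd w" "hd z = hd u"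
      | (IL) "hd u \<noteq> hd z" "hd w = hd v" | (II) "hd v = hd w" "hd z = hd u" by argo
    then show "c' {v, w} \<noteq> c' {z, u}"
    proof cases
      case LL
      obtain g h where vw: "v = [g, h, h]" "w = [h, g, g]"
        using E(1) LL by (auto elim!: sierp_adj_3E)
      obtain p q where zu: "z = [p, q, q]" "u = [q, p, p]" "adj p q"
        using E(3) LL by (auto elim!: sierp_adj_3E)
      show ?thesis using E(2) vw zu ne by (auto simp: sierp_adj_3 sierp_adj_2)
    next
      case LI
      then show ?thesis using link_inner[OF E ne] by simp
    next
      case IL
      then have "c' {u, z} \<noteq> c' {w, v}"
        using link_inner[OF sierp_adj_sym[OF E(3)] sierp_adj_sym[OF E(2)] sierp_adj_sym[OF E(1)] ne(2,1)] by simp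
      then show ?thesis by (simp add: insert_commute)
    next
      case II
      obtain g s t where vw: "v = g # s" "w = g # t" "S 2 s t"
        using E(1) II by (auto elim!: sierp_adj_3E)
      obtain h p q where zu: "z = h # p" "u = h # q" "S 2 p q"
        using E(3) II by (auto elim!: sierp_adj_3E)
      show ?thesis
      proof (cases "g = h")
        case True
        then have "S 2 t p" using E(2) vw zu by (simp add: sierp_adj_3)
        then have "d {s, t} \<noteq> d {p, q}"
          using inj_edge_coloringD[OF d(1) _ vw(3) _ zu(3)] vw zu ne True by simp
        then show ?thesis
          using cD[OF E ne] c'_d c'_c vw zu True by (cases "h = a \<or> h = b") auto
      next
        case False
        then have gh: "adj g h" "t = [h, h]" "p = [g, g]"
          using E(2) vw zu by (auto simp: sierp_adj_3)
        have st: "S 2 [h, h] s" "S 2 [g, g] q" using vw zu gh sierp_adj_sym by auto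
        have key: "d {s, [b, b]} \<noteq> K" "d {[b, b], s} \<noteq> K" if "S 2 [b, b] s" for s
        proof -
          have "cb {s, [b, b]} \<noteq> K" using rim[OF that sierp_adj_sym[OF that]] .
          then show "d {s, [b, b]} \<noteq> K" using d(4)[OF sierp_adj_sym[OF that]] ab by simp
          then show "d {[b, b], s} \<noteq> K" by (simp add: insert_commute)
        qed
        have dK: "d {[a, a], s} = K" "d {s, [a, a]} = K" if "S 2 [a, a] s" for s
        proof -
          have "s = [a, b]" using that by (auto elim!: sierp_adj_2E simp: N)
          then show "d {[a, a], s} = K" "d {s, [a, a]} = K"
            using d(2) by (simp_all add: insert_commute)
        qed
        show ?thesis
        proof (cases "g = a \<or> h = a")
          case True
          \<comment> \<open>Here the bridge is the middle edge: the edge at \<open>[b, a, a]\<close>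
            has color \<open>K\<close>, the one at \<open>[a, b, b]\<close> does not.\<close>
          then consider "g = a" "h = b" | "g = b" "h = a" using gh N Na by auto
          then show ?thesis
            using key dK st c'_d vw zu gh by cases (simp_all, metis+)
        next
          case False
          have "c' {w, v} = c {w, v}"
            using corner[of g h s t] False gh st vw sierp_adj_sym by (metis insert_commute)
          moreover have "c' {u, z} = c {u, z}"
            using corner[of h g q p] False gh st zu sierp_adj_sym adj_sym by (metis insert_commute)
          ultimately show ?thesis using cD[OF E ne] by (simp add: insert_commute)
        qed
      qed
    qed
  qed
  moreover have "c' {[u, u, u], y} = K" if u: "u \<in> A" "S 3 [u, u, u] y" for u y
  proof -
    obtain x where y: "y = [u, u, x]" "adj u x"
      using u(2) by (auto elim!: sierp_adj_3E sierp_adj_2E)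
    show ?thesis
    proof (cases "u = a")
      case True
      then show ?thesis using y N c'_d d(2) by simp
    next
      case False
      moreover have "u \<noteq> b" using u(1) a AB by auto
      ultimately show ?thesis using cK[OF u] c'_c y by simp
    qed
  qed
  moreover have "clear_rim 3 c' K v" if v: "v \<in> B" for v
    unfolding clear_rim_def
  proof (intro allI impI, elim conjE)
    fix y u
    assume E0: "S 3 (replicate 3 v) y" "S 3 y u"
    then have E: "S 3 [v, v, v] y" "S 3 y u" by (simp_all add: numeral_3_eq_3)
    obtain y' u' where 1: "y = v # y'" "u = v # u'" "S 2 [v, v] y'" "S 2 y' u'"
      using sierp_nbhd_3[OF E sierp_adj_sym[OF E(2)]] by metis
    have "v \<noteq> a" using v a AB by auto
    have "hd y' = v" using 1(3) by (auto elim!: sierp_adj_2E)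
    then have "c' {y, u} = c {y, u}"
      using c'_b[OF 1(4)] c'_c 1 \<open>v \<noteq> a\<close> by (cases "v = b") auto
    then show "c' {y, u} \<noteq> K" using cB[OF v] E0 unfolding clear_rim_def by auto
  qed
  ultimately have star: "star_coloring K A B c'" unfolding star_coloring_def by blast
  have "c' {[a, a, x], t} \<noteq> K" if t: "adj a x" "S 3 [a, a, x] t" "t \<noteq> [a, a, a]" for x t
  proof -
    have "x = b" using t N by simp
    then obtain t' where "t = a # t'" "S 2 [a, b] t'"
      using t ab by (auto elim!: sierp_adj_3E)
    then show ?thesis using \<open>x = b\<close> d(3)[of t'] t c'_d by auto
  qed
  then have "clear_center 3 c' K a"
    using clear_center_if_star_coloring[OF star a(1)] by blast
  moreover have "clear_center 3 c' K u" if u: "u \<in> A" "clear_center 3 c K u" "u \<noteq> a" for u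
    unfolding clear_center_def
  proof (intro allI impI, elim conjE)
    fix x y z
    assume *: "S 3 (replicate 3 u) x" "S 3 x y" "y \<noteq> replicate 3 u" "S 3 y z"
    then have E: "S 3 [u, u, u] x" by (simp add: numeral_3_eq_3)
    obtain y' z' where 1: "y = u # y'" "z = u # z'"
      using sierp_nbhd_3[OF E *(2,4)] by metis
    have "u \<noteq> b" using u a AB by auto
    then have "c' {y, z} = c {y, z}" using 1 u c'_c by simp
    then show "c' {y, z} \<noteq> K" using u(2) * unfolding clear_center_def by metis
  qed
  ultimately show ?thesis using that star by metis
qed

text \<open>Non-pendant vertices satisfy \<open>clear_center\<close> already; each pendant one costs
  a recoloring that preserves what was achieved before.\<close>

lemma star_coloring_clear_centers:
  assumes c: "star_coloring K A B c" and K: "K \<ge> 1" and AB: "bipartition V adj A B"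
    and F: "finite F" "F \<subseteq> A"
  shows "\<exists>c. star_coloring K A B c \<and> (\<forall>a\<in>F. clear_center 3 c K a)"
  using F
proof (induction F)
  case empty
  then show ?case using c by auto
next
  case (insert a F)
  then obtain c where c: "star_coloring K A B c" "\<forall>a\<in>F. clear_center 3 c K a" by auto
  have aA: "a \<in> A" using insert.prems by simp
  show ?case
  proof (cases "\<exists>b. \<forall>x. adj a x \<longleftrightarrow> x = b")
    case True
    then obtain b where b: "\<And>x. adj a x \<longleftrightarrow> x = b" by blast
    have "A \<inter> B = {}" "b \<in> B"
      using AB b[of b] aA unfolding bipartition_def by auto
    then obtain c' where c': "star_coloring K A B c'" "clear_center 3 c' K a"
      "\<And>u. u \<in> A \<Longrightarrow> clear_center 3 c K u \<Longrightarrow> clear_center 3 c' K u"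
      using pendant_recolor[OF c(1) K _ aA _ b] by metis
    have "clear_center 3 c' K u" if "u \<in> F" for u
      using c'(3)[of u] c(2) insert.prems that by auto
    with c' show ?thesis by (intro exI[of _ c'] conjI ballI) auto
  next
    case False
    then have "clear_center 3 c K a"
      using clear_center_if_star_coloring[OF c(1) aA] by metis
    with c show ?thesis by (intro exI[of _ c] conjI ballI) auto
  qed
qed

end

section \<open>From distance conditions to the theorem\<close>

lemma gdist_le: "(adj ^^ j) x y \<Longrightarrow> gdist adj x y \<le> enat j"
  unfolding gdist_def by (auto intro: Least_le)

theorem mainTheorem6:
  fixes V :: "'a set" and adj :: "'a \<Rightarrow> 'a \<Rightarrow> bool"
  assumes "finite V" and "simple_graph V adj" and "triangle_free adj" and "has_edge adj"
  defines "S \<equiv> sierp_adj V adj"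
  defines "k \<equiv> inj_chromatic_index (S 3)"
  shows "(\<forall>n \<ge> 3. k \<le> inj_chromatic_index (S n) \<and> inj_chromatic_index (S n) \<le> k + 1)
    \<and> (((\<exists>c. inj_edge_coloring (S 3) k c \<and>
            (\<forall>x y u. S 3 x y \<and> c {x, y} = k \<and> u \<in> V \<longrightarrow>
                gdist (S 3) x (extreme_vertex 3 u) \<ge> 3))
         \<or> (\<exists>A B. bipartition V adj A B \<and>
             (\<exists>c. inj_edge_coloring (S 3) k c \<and>
               (\<forall>u \<in> A. \<forall>y. S 3 (extreme_vertex 3 u) y \<longrightarrow> c {extreme_vertex 3 u, y} = k) \<and>
               (\<forall>x y v. S 3 x y \<and> c {x, y} = k \<and> v \<in> B \<longrightarrow>
                  gdist (S 3) x (extreme_vertex 3 v) \<ge> 2))))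
       \<longrightarrow> (\<forall>n \<ge> 3. inj_chromatic_index (S n) = k))"
proof -
  interpret G: sgraph V adj by unfold_locales (fact assms(2))
  note tf = assms(3)
  have S: "S = G.S" by (simp add: S_def)
  obtain a0 b0 where ab0: "adj a0 b0" using assms(4) unfolding has_edge_def by blast
  then have V: "a0 \<in> V" "V \<noteq> {}" using G.adj_V by auto
  obtain c0 where c0: "inj_edge_coloring (S 3) k c0"
    using inj_chromatic_index_attained[OF G.finite_edges_sierp[OF assms(1), of 3]]
    unfolding k_def S_def by blast
  have "S 3 [a0, a0, a0] [a0, a0, b0]"
    using ab0 V by (simp add: S G.sierp_adj_3 G.sierp_adj_2)
  then have k1: "k \<ge> 1" using inj_edge_coloring_range[OF c0] by fastforce
  have lower: "k \<le> inj_chromatic_index (S n)" if "n \<ge> 3" for n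
    using G.inj_chromatic_index_sierp_mono[OF assms(1) V(2) that] unfolding k_def S_def .
  \<comment> \<open>Any orientation serves for the upper bound and for (i); comparing the values of
    an injection into the naturals gives one.\<close>
  obtain f :: "'a \<Rightarrow> nat" where f: "inj_on f V"
    using finite_imp_inj_to_nat_seg[OF assms(1)] by blast
  have orient: "f a < f b \<longleftrightarrow> \<not> f b < f a" if "adj a b" for a b
    using f G.adj_V[OF that] that by (metis G.adj_irrefl inj_onD linorder_neqE_nat order_less_asym)
  have upper: "inj_chromatic_index (S n) \<le> k + 1" if n: "n \<ge> 3" for n
  proof -
    have "c0 {x, y} \<noteq> k + 1" if "S 3 x y" for x y
      using inj_edge_coloring_range[OF c0 that] by auto
    then have "G.clear_center 3 c0 (k + 1) a" "G.clear_rim 3 c0 (k + 1) a" for a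
      unfolding G.clear_center_def G.clear_rim_def S by blast+
    moreover have "inj_edge_coloring (G.S 3) (k + 1) c0"
      using c0 unfolding inj_edge_coloring_def S by fastforce
    ultimately show ?thesis
      using G.inj_chromatic_index_sierp_le[OF n tf _ _ orient, of "k + 1" c0] S by simp
  qed
  have far_case: "inj_chromatic_index (S n) = k"
    if c: "inj_edge_coloring (S 3) k c" and n: "n \<ge> 3"
      and far: "\<forall>x y u. S 3 x y \<and> c {x, y} = k \<and> u \<in> V \<longrightarrow> gdist (S 3) x (extreme_vertex 3 u) \<ge> 3"
    for c n
  proof -
    have "G.clear_center 3 c k a" if "a \<in> V" for a
      unfolding G.clear_center_def S[symmetric] extreme_vertex_def[symmetric]
    proof (intro allI impI notI, elim conjE)
      fix y z u
      assume *: "S 3 (extreme_vertex 3 a) y" "S 3 y z" "S 3 z u" "c {z, u} = k"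
      have "(S 3 ^^ 2) z (extreme_vertex 3 a)"
        using *(1,2) G.sierp_adj_sym unfolding S by (auto simp: numeral_2_eq_2 relcompp_apply)
      then have "gdist (S 3) z (extreme_vertex 3 a) \<le> 2"
        using gdist_le by (metis enat_numeral)
      moreover have "gdist (S 3) z (extreme_vertex 3 a) \<ge> 3" using far * that by blast
      ultimately have "(3::enat) \<le> 2" by (rule order_trans[rotated])
      then show False by simp
    qed
    moreover have "G.clear_rim 3 c k a" if "a \<in> V" for a
      unfolding G.clear_rim_def S[symmetric] extreme_vertex_def[symmetric]
    proof (intro allI impI notI, elim conjE)
      fix y u
      assume *: "S 3 (extreme_vertex 3 a) y" "S 3 y u" "c {y, u} = k"
      have "(S 3 ^^ 1) y (extreme_vertex 3 a)"
        using *(1) G.sierp_adj_sym unfolding S by auto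
      then have "gdist (S 3) y (extreme_vertex 3 a) \<le> 1"
        using gdist_le by (metis one_enat_def)
      moreover have "gdist (S 3) y (extreme_vertex 3 a) \<ge> 3" using far * that by blast
      ultimately have "(3::enat) \<le> 1" by (rule order_trans[rotated])
      then show False by simp
    qed
    ultimately have "inj_chromatic_index (S n) \<le> k"
      using G.inj_chromatic_index_sierp_le[OF n tf _ k1 orient, of c] c G.adj_V S by simp
    then show ?thesis using lower[OF n] by simp
  qed
  have star_case: "inj_chromatic_index (S n) = k"
    if AB: "bipartition V adj A B" and c: "inj_edge_coloring (S 3) k c" and n: "n \<ge> 3"
      and star: "\<forall>u \<in> A. \<forall>y. S 3 (extreme_vertex 3 u) y \<longrightarrow> c {extreme_vertex 3 u, y} = k"
      and far: "\<forall>x y v. S 3 x y \<and> c {x, y} = k \<and> v \<in> B \<longrightarrow> gdist (S 3) x (extreme_vertex 3 v) \<ge> 2"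
    for A B c n
  proof -
    have "G.clear_rim 3 c k v" if "v \<in> B" for v
      unfolding G.clear_rim_def S[symmetric] extreme_vertex_def[symmetric]
    proof (intro allI impI notI, elim conjE)
      fix y u
      assume *: "S 3 (extreme_vertex 3 v) y" "S 3 y u" "c {y, u} = k"
      have "(S 3 ^^ 1) y (extreme_vertex 3 v)"
        using *(1) G.sierp_adj_sym unfolding S by auto
      then have "gdist (S 3) y (extreme_vertex 3 v) \<le> 1"
        using gdist_le by (metis one_enat_def)
      moreover have "gdist (S 3) y (extreme_vertex 3 v) \<ge> 2" using far * that by blast
      ultimately have "(2::enat) \<le> 1" by (rule order_trans[rotated])
      then show False by simp
    qed
    then have "G.star_coloring k A B c"
      using c star unfolding G.star_coloring_def S extreme_vertex_def by (simp add: numeral_3_eq_3)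
    moreover have "finite A" using AB assms(1) unfolding bipartition_def by (metis finite_Un)
    ultimately obtain c' where c': "G.star_coloring k A B c'" "\<forall>a\<in>A. G.clear_center 3 c' k a"
      using G.star_coloring_clear_centers[OF _ k1 AB] by blast
    have "inj_chromatic_index (S n) \<le> k"
      unfolding S
    proof (rule G.inj_chromatic_index_sierp_le[OF n tf _ k1])
      show "inj_edge_coloring (G.S 3) k c'" using c' unfolding G.star_coloring_def by simp
      \<comment> \<open>This instantiates \<open>toward a b\<close> with \<open>a \<in> A\<close>,
        so the recolored stars sit at extreme vertices \<open>a\<close> of the copies, with
        \<open>a\<close> in \<open>A\<close>.\<close>
      show "a \<in> A \<longleftrightarrow> \<not> b \<in> A" if "adj a b" for a b
        using AB that unfolding bipartition_def by blast
      show "G.clear_center 3 c' k a" if "a \<in> A" for a using c' that by blast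
      show "G.clear_rim 3 c' k b" if "adj a b" "a \<in> A" for a b
        using c' AB that unfolding bipartition_def G.star_coloring_def by blast
    qed
    then show ?thesis using lower[OF n] by simp
  qed
  show ?thesis
  proof (intro conjI allI impI, goal_cases)
    case (1 n)
    then show ?case by (rule lower)
  next
    case (2 n)
    then show ?case by (rule upper)
  next
    case (3 n)
    from 3(1) show ?case
    proof (elim disjE exE conjE, goal_cases)
      case (1 c)
      then show ?case using far_case 3(2) by metis
    next
      case (2 A B c)
      then show ?case using star_case 3(2) by metis
    qed
  qed
qed

end
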